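(* Let $S \subset \mathbb{R}^n$ ($n\ge1$) be a bounded rational polyhedral subset. Let $f: S \cap \mathbb{Q}^n \to \mathbb{R}$ be a $\mathbb{Q}$-convex function such that for each rational line segment $\ell\subseteq S$ the restriction of $f$ to $\ell\cap\mathbb{Q}^n$ is continuous, and such that \[ f(x_1, \dots, x_n) \in \mathbb{Z} + \mathbb{Z} x_1 + \cdots + \mathbb{Z} x_n \qquad \text{for all } (x_1, \dots, x_n) \in S \cap \mathbb{Q}^n. \] Then $f$ is integral polyhedral.
   Context: An affine functional $\lambda(x_1,\dots,x_n)=a_1x_1+\cdots+a_nx_n+b$ on $\mathbb{R}^n$ is integral if $a_1,\dots,a_n,b\in\mathbb{Z}$. A rational polyhedral subset of $\mathbb{R}^n$ is an intersection of finitely many closed halfspaces $\{x:\lambda(x)\ge 0\}$ with each $\lambda$ an integral affine functional with $(a_1,\dots,a_n)\ne0$ (equivalently one may allow $b\in\mathbb{Q}$); a rational line segment is a line segment that is a rational polyhedral subset. A function $f$ on $S\cap\mathbb{Q}^n$ is $\mathbb{Q}$-convex if $tf(x)+(1-t)f(y)\ge f(tx+(1-t)y)$ for all $x,y\in S\cap\mathbb{Q}^n$ and $t\in[0,1]\cap\mathbb{Q}$. For any $T\subseteq\mathbb{R}^n$, a function $g:T\to\mathbb{R}$ is integral polyhedral if $g(x)=\max\{\lambda_1(x),\dots,\lambda_m(x)\}$ for all $x\in T$, for some finite list of integral affine functionals $\lambda_1,\dots,\lambda_m$ on $\mathbb{R}^n$. *)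

theory Defs
  imports "HOL-Analysis.Analysis"
begin

definition int_affine :: "int ^ 'n \<Rightarrow> int \<Rightarrow> real ^ 'n \<Rightarrow> real" where
  "int_affine a b x = (\<Sum>i\<in>UNIV. of_int (a $ i) * x $ i) + of_int b"

definition rational_points :: "(real ^ 'n) set" where
  "rational_points = {x. \<forall>i. x $ i \<in> \<rat>}"

definition rational_halfspace :: "(real ^ 'n) set \<Rightarrow> bool" where
  "rational_halfspace H \<longleftrightarrow> (\<exists>a b. a \<noteq> 0 \<and> H = {x. int_affine a b x \<ge> 0})"

definition rational_polyhedral :: "(real ^ 'n) set \<Rightarrow> bool" where
  "rational_polyhedral S \<longleftrightarrow>
     (\<exists>\<H>. finite \<H> \<and> (\<forall>H\<in>\<H>. rational_halfspace H) \<and> S = \<Inter>\<H>)"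

definition rational_line_segment :: "(real ^ 'n) set \<Rightarrow> bool" where
  "rational_line_segment l \<longleftrightarrow>
     (\<exists>u v. u \<noteq> v \<and> l = closed_segment u v) \<and> rational_polyhedral l"

text \<open>Intended for convex \<open>S\<close>, where the convex combination is again a rational point of \<open>S\<close>;
  the values of \<open>f\<close> elsewhere are then irrelevant.\<close>

definition Q_convex_on :: "(real ^ 'n) set \<Rightarrow> (real ^ 'n \<Rightarrow> real) \<Rightarrow> bool" where
  "Q_convex_on S f \<longleftrightarrow>
     (\<forall>x\<in>S \<inter> rational_points. \<forall>y\<in>S \<inter> rational_points. \<forall>t\<in>{0..1} \<inter> \<rat>.
        t * f x + (1 - t) * f y \<ge> f (t *\<^sub>R x + (1 - t) *\<^sub>R y))"

definition integral_polyhedral_on :: "(real ^ 'n) set \<Rightarrow> (real ^ 'n \<Rightarrow> real) \<Rightarrow> bool" where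
  "integral_polyhedral_on T g \<longleftrightarrow>
     (\<exists>L :: ((int ^ 'n) \<times> int) set. finite L \<and> L \<noteq> {} \<and>
        (\<forall>x\<in>T. g x = Max ((\<lambda>(a, b). int_affine a b x) ` L)))"

end

theory Submission
  imports Defs
begin

text \<open>
  Homogenise: the integer points \<open>p = (v, t)\<close> of the cone over \<open>S\<close> form a monoid \<open>M\<close>, and
  \<open>F p = t f (v / t)\<close> is an integer-valued sublinear function on it. For \<open>c \<in> M\<close> the increments
  \<open>F (k c + v) - k F c\<close> are integers, nonincreasing and convex in \<open>k\<close>, and continuity along
  the rational segment from \<open>c\<close> to \<open>v\<close> makes them \<open>o(k)\<close>; hence they are eventually constant,
  which gives an integral one-sided derivative of \<open>F\<close> at \<open>c\<close>. Differentiating again at an order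
  unit of the cone yields a sublinear function on a lattice, and differentiating along a basis
  of that lattice an integral functional below \<open>F\<close> that touches it at \<open>c\<close>. Since \<open>M\<close> is finitely
  generated, Dickson's lemma, applied to the gaps between such functionals and \<open>F\<close> at the
  generators, leaves finitely many of them.
\<close>

section \<open>Integer pairings, sublinear functions on monoids, and lattices\<close>

definition idot :: "int ^ 'm \<Rightarrow> int ^ 'm \<Rightarrow> int" where
  "idot a x = (\<Sum>i\<in>UNIV. a $ i * x $ i)"

lemma idot_add: "idot a (x + y) = idot a x + idot a y"
  by (simp add: idot_def algebra_simps sum.distrib)

lemma idot_diff: "idot a (x - y) = idot a x - idot a y"
  by (simp add: idot_def algebra_simps sum_subtractf)

lemma idot_scale: "idot a (k *s x) = k * idot a x"
  by (simp add: idot_def algebra_simps sum_distrib_left)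

lemma idot_zero: "idot a 0 = 0"
  by (simp add: idot_def)

lemma idot_axis: "idot (axis i 1) x = x $ i"
proof -
  have "idot (axis i 1) x = (\<Sum>j\<in>UNIV. if j = i then x $ j else 0)"
    unfolding idot_def by (intro sum.cong) (auto simp: axis_def)
  then show ?thesis by simp
qed

text \<open>Closure of \<open>M\<close> is built in because each derivative below comes with its own
  larger domain. Scaling is by naturals only, since \<open>M\<close> may be a cone; the case
  \<open>k = 0\<close> gives \<open>F 0 = 0\<close> whenever \<open>M\<close> is nonempty.\<close>

definition sublinear_on :: "(int ^ 'm) set \<Rightarrow> (int ^ 'm \<Rightarrow> int) \<Rightarrow> bool" where
  "sublinear_on M F \<longleftrightarrow>
     (\<forall>x\<in>M. \<forall>y\<in>M. x + y \<in> M \<and> F (x + y) \<le> F x + F y) \<and>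
     (\<forall>x\<in>M. \<forall>k::nat. int k *s x \<in> M \<and> F (int k *s x) = int k * F x)"

lemma sublinear_onD:
  assumes "sublinear_on M F" "x \<in> M"
  shows "y \<in> M \<Longrightarrow> x + y \<in> M" "y \<in> M \<Longrightarrow> F (x + y) \<le> F x + F y"
    "int k *s x \<in> M" "F (int k *s x) = int k * F x"
  using assms by (auto simp: sublinear_on_def)

definition lattice_subgroup :: "(int ^ 'm) set \<Rightarrow> bool" where
  "lattice_subgroup K \<longleftrightarrow>
     0 \<in> K \<and> (\<forall>x\<in>K. \<forall>y\<in>K. x + y \<in> K) \<and> (\<forall>x\<in>K. \<forall>k. k *s x \<in> K)"

lemma lattice_subgroupD:
  assumes "lattice_subgroup K"
  shows "0 \<in> K" "x \<in> K \<Longrightarrow> y \<in> K \<Longrightarrow> x + y \<in> K" "x \<in> K \<Longrightarrow> k *s x \<in> K"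
    "x \<in> K \<Longrightarrow> y \<in> K \<Longrightarrow> x - y \<in> K"
proof -
  show "0 \<in> K" "x \<in> K \<Longrightarrow> y \<in> K \<Longrightarrow> x + y \<in> K" "x \<in> K \<Longrightarrow> k *s x \<in> K" for x y k
    using assms by (auto simp: lattice_subgroup_def)
  then have "x \<in> K \<Longrightarrow> y \<in> K \<Longrightarrow> x + (-1) *s y \<in> K" by blast
  moreover have "x + (-1) *s y = x - y" by (simp add: vec_eq_iff)
  ultimately show "x \<in> K \<Longrightarrow> y \<in> K \<Longrightarrow> x - y \<in> K" by simp
qed

definition int_linear_on :: "(int ^ 'm) set \<Rightarrow> (int ^ 'm \<Rightarrow> int) \<Rightarrow> bool" where
  "int_linear_on K a \<longleftrightarrow>
     (\<forall>x\<in>K. \<forall>y\<in>K. a (x + y) = a x + a y) \<and> (\<forall>x\<in>K. \<forall>k. a (k *s x) = k * a x)"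

lemma int_linear_onD:
  assumes "int_linear_on K a" "x \<in> K"
  shows "y \<in> K \<Longrightarrow> a (x + y) = a x + a y" "a (k *s x) = k * a x"
  using assms by (auto simp: int_linear_on_def)

section \<open>One-sided derivatives of integral sublinear functions\<close>

text \<open>Integers bounded below attain their least value, and a nonincreasing sequence can never
  leave it.\<close>

lemma antimono_int_eventually_const:
  fixes m :: "nat \<Rightarrow> int"
  assumes dec: "\<And>k. m (Suc k) \<le> m k" and bdd: "\<And>k. B \<le> m k"
  shows "\<exists>d K. \<forall>k\<ge>K. m k = d"
proof -
  define g where "g k = nat (m k - B)" for k
  define K where "K = (ARG_MIN g k. True)"
  have min: "g K \<le> g k" for k
    unfolding K_def by (rule arg_min_nat_le) simp
  have "decseq m" using dec by (simp add: decseq_Suc_iff)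
  then have le: "m k \<le> m K" if "k \<ge> K" for k using that by (simp add: decseq_def)
  have "m k = m K" if "k \<ge> K" for k
    using min[of k] le[OF that] bdd[of k] bdd[of K] by (simp add: g_def)
  then show ?thesis by blast
qed

text \<open>\<open>D v\<close> is the eventual value of \<open>F (k c + v) - k F c\<close>:
  subadditivity makes these integers nonincreasing in \<open>k\<close>, so the lower bound makes
  them stabilise. The domain is \<open>M\<close> with \<open>c\<close> made invertible, and
  \<open>D\<close> is linear along all integer multiples of \<open>c\<close>.\<close>

lemma sublinear_derivative:
  assumes F: "sublinear_on M F" and c: "c \<in> M"
    and bdd: "\<forall>v\<in>M. \<exists>B. \<forall>k. B \<le> F (int k *s c + v) - int k * F c"
  obtains D where "sublinear_on {v. \<exists>k. int k *s c + v \<in> M} D"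
    "\<forall>v\<in>M. D v \<le> F v"
    "\<forall>v j. (\<exists>k. int k *s c + v \<in> M) \<longrightarrow> D (j *s c + v) = j * F c + D v"
proof -
  define M' where "M' = {v. \<exists>k. int k *s c + v \<in> M}"
  have evM: "\<forall>\<^sub>F k in sequentially. int k *s c + v \<in> M" if v: "v \<in> M'" for v
  proof -
    obtain k where k: "int k *s c + v \<in> M" using v by (auto simp: M'_def)
    have "int j *s c + v \<in> M" if "j \<ge> k" for j
    proof -
      have "int (j - k) *s c + (int k *s c + v) \<in> M"
        using sublinear_onD(1)[OF F sublinear_onD(3)[OF F c] k] .
      moreover have "int (j - k) *s c + (int k *s c + v) = int j *s c + v"
        using that by (simp add: vec_eq_iff of_nat_diff algebra_simps)
      ultimately show ?thesis by simp
    qed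
    then show ?thesis by (auto simp: eventually_sequentially)
  qed
  have ex: "\<exists>d K. \<forall>k\<ge>K. F (int k *s c + v) - int k * F c = d" if v: "v \<in> M" for v
  proof -
    obtain B where B: "\<forall>k. B \<le> F (int k *s c + v) - int k * F c" using bdd v by blast
    show ?thesis
    proof (rule antimono_int_eventually_const)
      fix k
      have "int k *s c + v \<in> M"
        using sublinear_onD(1)[OF F sublinear_onD(3)[OF F c] v] .
      then have "F (c + (int k *s c + v)) \<le> F c + F (int k *s c + v)"
        using sublinear_onD(2)[OF F c] by blast
      moreover have "c + (int k *s c + v) = int (Suc k) *s c + v"
        by (simp add: vec_eq_iff algebra_simps)
      ultimately show "F (int (Suc k) *s c + v) - int (Suc k) * F c \<le> F (int k *s c + v) - int k * F c"
        by (simp add: algebra_simps)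
    qed (use B in auto)
  qed
  \<comment> \<open>A bound is given only for vectors of \<open>M\<close>. In general the sequence
    is started at \<open>j c + v\<close> in \<open>M\<close>, which changes the eventual value by
    \<open>j F c\<close>.\<close>
  have "\<exists>d. \<forall>\<^sub>F k in sequentially. F (int k *s c + v) = int k * F c + d" if v: "v \<in> M'" for v
  proof -
    obtain j where j: "int j *s c + v \<in> M" using v by (auto simp: M'_def)
    obtain d K where dK: "\<And>k. k \<ge> K \<Longrightarrow> F (int k *s c + (int j *s c + v)) - int k * F c = d"
      using ex[OF j] by blast
    have "F (int k *s c + v) = int k * F c + (d - int j * F c)" if "k \<ge> K + j" for k
    proof -
      have "int (k - j) *s c + (int j *s c + v) = int k *s c + v"
        using that by (simp add: vec_eq_iff of_nat_diff algebra_simps)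
      then show ?thesis using dK[of "k - j"] that by (simp add: of_nat_diff algebra_simps)
    qed
    then show ?thesis unfolding eventually_sequentially by blast
  qed
  then have "\<forall>v\<in>M'. \<exists>d. \<forall>\<^sub>F k in sequentially. F (int k *s c + v) = int k * F c + d" by blast
  from bchoice[OF this] obtain D
    where evD: "\<And>v. v \<in> M' \<Longrightarrow> \<forall>\<^sub>F k in sequentially. F (int k *s c + v) = int k * F c + D v"
    by blast
  have shift: "D w = d" if w: "w \<in> M'" and e: "\<forall>\<^sub>F k in sequentially. F (int k *s c + w) = int k * F c + d" for w d
  proof -
    have "\<forall>\<^sub>F k::nat in sequentially. D w = d"
      using evD[OF w] e by eventually_elim simp
    then show ?thesis by simp
  qed
  have sub: "sublinear_on M' D"
    unfolding sublinear_on_def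
  proof (intro conjI ballI allI)
    fix x y assume x: "x \<in> M'" and y: "y \<in> M'"
    obtain K where K: "\<And>k. k \<ge> K \<Longrightarrow> int k *s c + x \<in> M \<and> int k *s c + y \<in> M"
      using eventually_conj[OF evM[OF x] evM[OF y]] by (auto simp: eventually_sequentially)
    have dbl: "int (2 * k) *s c + (x + y) = (int k *s c + x) + (int k *s c + y)" for k
      by (simp add: vec_eq_iff algebra_simps)
    show xy: "x + y \<in> M'"
    proof -
      have "int (2 * K) *s c + (x + y) \<in> M"
        unfolding dbl using K[OF order_refl] sublinear_onD(1)[OF F] by blast
      then show ?thesis unfolding M'_def by blast
    qed
    \<comment> \<open>The increments of \<open>x\<close> and \<open>y\<close> at \<open>k\<close>
      are compared with that of \<open>x + y\<close> at \<open>2 k\<close>, so the eventual formula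
      for \<open>x + y\<close> is used along even indices.\<close>
    have two: "filterlim (\<lambda>k::nat. 2 * k) sequentially sequentially"
      by (rule filterlim_subseq) (simp add: strict_mono_def)
    have "\<forall>\<^sub>F k in sequentially. F (int (2 * k) *s c + (x + y)) = int (2 * k) * F c + D (x + y)"
      using two evD[OF xy] by (rule eventually_compose_filterlim[rotated])
    with evM[OF x] evM[OF y] evD[OF x] evD[OF y]
    have "\<forall>\<^sub>F k::nat in sequentially. D (x + y) \<le> D x + D y"
    proof eventually_elim
      case (elim k)
      have "F (int (2 * k) *s c + (x + y)) \<le> F (int k *s c + x) + F (int k *s c + y)"
        unfolding dbl by (rule sublinear_onD(2)[OF F elim(1,2)])
      then show ?case using elim by (simp add: algebra_simps)
    qed
    then show "D (x + y) \<le> D x + D y" by simp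
  next
    fix x and k :: nat assume x: "x \<in> M'"
    have mul: "int (k * j) *s c + int k *s x = int k *s (int j *s c + x)" for j
      by (simp add: vec_eq_iff algebra_simps)
    show kx: "int k *s x \<in> M'"
    proof -
      obtain j where "int j *s c + x \<in> M" using x by (auto simp: M'_def)
      then have "int (k * j) *s c + int k *s x \<in> M"
        unfolding mul by (rule sublinear_onD(3)[OF F])
      then show ?thesis unfolding M'_def by blast
    qed
    show "D (int k *s x) = int k * D x"
    \<comment> \<open>For \<open>k = 0\<close> the indices \<open>k * j\<close> do not tend to
      infinity, so this case is separate.\<close>
    proof (cases "k = 0")
      case True
      have "F 0 = 0" using sublinear_onD(4)[OF F c, of 0] by (simp add: vector_smult_lzero)
      have "D 0 = 0"
      proof (rule shift)
        show "0 \<in> M'" using kx True by (simp add: vector_smult_lzero)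
        show "\<forall>\<^sub>F k in sequentially. F (int k *s c + 0) = int k * F c + 0"
          using sublinear_onD(4)[OF F c] by simp
      qed
      then show ?thesis using True by (simp add: vector_smult_lzero)
    next
      case False
      then have "filterlim (\<lambda>j::nat. k * j) sequentially sequentially"
        by (intro filterlim_subseq) (simp add: strict_mono_def)
      then have "\<forall>\<^sub>F j in sequentially. F (int (k * j) *s c + int k *s x) = int (k * j) * F c + D (int k *s x)"
        using evD[OF kx] by (rule eventually_compose_filterlim[rotated])
      with evM[OF x] evD[OF x] have "\<forall>\<^sub>F j::nat in sequentially. D (int k *s x) = int k * D x"
      proof eventually_elim
        case (elim j)
        then show ?case
          unfolding mul using sublinear_onD(4)[OF F elim(1), of k] by (simp add: algebra_simps)
      qed
      then show ?thesis by simp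
    qed
  qed
  show thesis
  proof (rule that)
    show "sublinear_on {v. \<exists>k. int k *s c + v \<in> M} D" using sub by (simp add: M'_def)
    show "\<forall>v\<in>M. D v \<le> F v"
    proof
      fix v assume v: "v \<in> M"
      then have v': "v \<in> M'" unfolding M'_def by (auto intro!: exI[of _ 0])
      from evD[OF v'] have "\<forall>\<^sub>F k::nat in sequentially. D v \<le> F v"
      proof eventually_elim
        case (elim k)
        then show ?case
          using sublinear_onD(2)[OF F sublinear_onD(3)[OF F c] v, of k] sublinear_onD(4)[OF F c, of k] by simp
      qed
      then show "D v \<le> F v" by simp
    qed
    show "\<forall>v j. (\<exists>k. int k *s c + v \<in> M) \<longrightarrow> D (j *s c + v) = j * F c + D v"
    proof (intro allI impI)
      fix v and j :: int assume "\<exists>k. int k *s c + v \<in> M"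
      then have v: "v \<in> M'" by (simp add: M'_def)
      obtain K where K: "\<And>k. k \<ge> K \<Longrightarrow> int k *s c + v \<in> M \<and> F (int k *s c + v) = int k * F c + D v"
        using eventually_conj[OF evM[OF v] evD[OF v]] by (auto simp: eventually_sequentially)
      \<comment> \<open>For negative \<open>j\<close> the shifted index \<open>k + j\<close> must
        remain a natural number, hence the threshold \<bar>j\<bar>.\<close>
      have eq: "int k *s c + (j *s c + v) = int (nat (int k + j)) *s c + v" if "k \<ge> nat \<bar>j\<bar>" for k
        using that by (simp add: vec_eq_iff algebra_simps)
      show "D (j *s c + v) = j * F c + D v"
      proof (rule shift)
        have "int (nat (int (K + nat \<bar>j\<bar>) + j)) *s c + v \<in> M" by (rule K[THEN conjunct1]) linarith
        then have "int (K + nat \<bar>j\<bar>) *s c + (j *s c + v) \<in> M"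
          by (subst eq) simp_all
        then show "j *s c + v \<in> M'" unfolding M'_def by blast
        have "F (int k *s c + (j *s c + v)) = int k * F c + (j * F c + D v)" if "k \<ge> K + nat \<bar>j\<bar>" for k
          using eq[of k] K[of "nat (int k + j)"] that by (simp add: algebra_simps)
        then show "\<forall>\<^sub>F k in sequentially. F (int k *s c + (j *s c + v)) = int k * F c + (j * F c + D v)"
          unfolding eventually_sequentially by blast
      qed
    qed
  qed
qed

section \<open>Linear minorants on lattices\<close>

text \<open>The image of \<open>\<phi>\<close> is a subgroup of \<int>, generated by its least
  positive value \<open>\<phi> g\<close>. If it is nonzero, \<open>q\<close> is the coordinate along
  \<open>g\<close>, and \<open>K\<close> splits into the multiples of \<open>g\<close> and the
  kernel; otherwise \<open>g = 0\<close> and \<open>q = 0\<close> serve.\<close>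

lemma lattice_subgroup_split:
  assumes K: "lattice_subgroup K" and \<phi>: "int_linear_on K \<phi>"
  obtains g q where "g \<in> K" "int_linear_on K q" "\<forall>x\<in>K. \<phi> x = q x * \<phi> g"
proof (cases "\<exists>x\<in>K. \<phi> x \<noteq> 0")
  case False
  show thesis
    by (rule that[of 0 "\<lambda>_. 0"]) (use False lattice_subgroupD(1)[OF K] in \<open>auto simp: int_linear_on_def\<close>)
next
  case True
  then obtain x where x: "x \<in> K" "\<phi> x \<noteq> 0" by blast
  have "\<exists>y\<in>K. \<phi> y > 0"
  proof (cases "\<phi> x > 0")
    case False
    have "\<phi> ((-1) *s x) = - \<phi> x" using int_linear_onD(2)[OF \<phi> x(1), of "-1"] by simp
    then have "\<phi> ((-1) *s x) > 0" using False x(2) by linarith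
    then show ?thesis using lattice_subgroupD(3)[OF K x(1)] by blast
  qed (use x in blast)
  define P where "P y \<longleftrightarrow> y \<in> K \<and> \<phi> y > 0" for y
  define g where "g = (ARG_MIN (\<lambda>y. nat (\<phi> y)) y. P y)"
  obtain y0 where "P y0" using \<open>\<exists>y\<in>K. \<phi> y > 0\<close> by (auto simp: P_def)
  then have g: "P g" and min: "\<And>y. P y \<Longrightarrow> nat (\<phi> g) \<le> nat (\<phi> y)"
    unfolding g_def using arg_min_nat_lemma[of P y0 "\<lambda>y. nat (\<phi> y)"] by auto
  have gK: "g \<in> K" and g0: "\<phi> g > 0" using g by (auto simp: P_def)
  have eq: "\<phi> y = (\<phi> y div \<phi> g) * \<phi> g" if y: "y \<in> K" for y
  proof -
    \<comment> \<open>Division with remainder inside \<open>K\<close>: \<open>z\<close> has value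
      \<open>\<phi> y mod \<phi> g\<close>, which minimality of \<open>\<phi> g\<close> forces to be
      0.\<close>
    define z where "z = y + (- (\<phi> y div \<phi> g)) *s g"
    have zK: "z \<in> K" unfolding z_def by (intro lattice_subgroupD[OF K] y gK)
    have "\<phi> z = \<phi> y - (\<phi> y div \<phi> g) * \<phi> g"
      unfolding z_def by (subst int_linear_onD(1)[OF \<phi> y lattice_subgroupD(3)[OF K gK]])
        (simp add: int_linear_onD(2)[OF \<phi> gK])
    then have z: "\<phi> z = \<phi> y mod \<phi> g" by (simp add: minus_div_mult_eq_mod)
    have "\<phi> z = 0"
    proof (rule ccontr)
      assume "\<phi> z \<noteq> 0"
      then have "\<phi> z > 0" using z g0 by (metis order_le_less pos_mod_sign)
      then have "P z" using zK by (simp add: P_def)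
      moreover have "\<phi> z < \<phi> g" using z g0 by simp
      ultimately show False using min[of z] \<open>\<phi> z > 0\<close> by simp
    qed
    then show ?thesis using z by (metis div_mult_mod_eq add.right_neutral)
  qed
  show thesis
  proof (rule that[of g "\<lambda>y. \<phi> y div \<phi> g"])
    show "int_linear_on K (\<lambda>y. \<phi> y div \<phi> g)"
      unfolding int_linear_on_def
    proof (intro conjI ballI allI)
      fix x y assume xy: "x \<in> K" "y \<in> K"
      have "\<phi> g dvd \<phi> x" using eq[OF xy(1)] by (metis dvd_triv_right)
      then show "\<phi> (x + y) div \<phi> g = \<phi> x div \<phi> g + \<phi> y div \<phi> g"
        by (simp add: int_linear_onD(1)[OF \<phi> xy] div_plus_div_distrib_dvd_left)
    next
      fix x k assume x: "x \<in> K"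
      have "\<phi> g dvd \<phi> x" using eq[OF x] by (metis dvd_triv_right)
      then show "\<phi> (k *s x) div \<phi> g = k * (\<phi> x div \<phi> g)"
        by (simp add: int_linear_onD(2)[OF \<phi> x] div_mult_swap)
    qed
  qed (use gK eq in auto)
qed

lemma int_linear_on_idot: "int_linear_on K (idot h)"
  by (simp add: int_linear_on_def idot_add idot_scale)

lemma lattice_subgroup_kernel:
  assumes "lattice_subgroup K"
  shows "lattice_subgroup {x\<in>K. idot h x = 0}"
  using assms by (auto simp: lattice_subgroup_def idot_add idot_scale idot_zero)

lemma lattice_subgroup_kernels: "lattice_subgroup {x. \<forall>h\<in>H. idot h x = 0}"
  by (auto simp: lattice_subgroup_def idot_add idot_scale idot_zero)

text \<open>Subtracting \<open>q x\<close> copies of \<open>g\<close> projects \<open>K\<close> to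
  the kernel of \<open>h\<close>. If \<open>idot h g \<noteq> 0\<close>, then
  \<open>q g = 1\<close>, and the formula extends \<open>a\<close> with value \<open>d\<close> at
  \<open>g\<close>.\<close>

lemma linear_extension_step:
  assumes K: "lattice_subgroup K" and g: "g \<in> K" and q: "int_linear_on K q"
    and hq: "\<And>x. x \<in> K \<Longrightarrow> idot h x = q x * idot h g"
    and a: "int_linear_on {x\<in>K. idot h x = 0} a"
  shows "int_linear_on K (\<lambda>x. a (x - q x *s g) + q x * d)"
proof -
  have mem: "x - q x *s g \<in> {x\<in>K. idot h x = 0}" if "x \<in> K" for x
    using that g hq[OF that] by (auto intro!: lattice_subgroupD[OF K] simp: idot_diff idot_scale)
  show ?thesis
    unfolding int_linear_on_def
  proof (intro conjI ballI allI)
    fix x y assume xy: "x \<in> K" "y \<in> K"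
    have "x + y - q (x + y) *s g = (x - q x *s g) + (y - q y *s g)"
      by (simp add: vec_eq_iff algebra_simps int_linear_onD(1)[OF q xy])
    then show "a (x + y - q (x + y) *s g) + q (x + y) * d
        = a (x - q x *s g) + q x * d + (a (y - q y *s g) + q y * d)"
      using int_linear_onD(1)[OF a mem mem] xy by (simp add: int_linear_onD(1)[OF q xy] algebra_simps)
  next
    fix x k assume x: "x \<in> K"
    have "k *s x - q (k *s x) *s g = k *s (x - q x *s g)"
      by (simp add: vec_eq_iff algebra_simps int_linear_onD(2)[OF q x])
    then show "a (k *s x - q (k *s x) *s g) + q (k *s x) * d = k * (a (x - q x *s g) + q x * d)"
      using int_linear_onD(2)[OF a mem] x by (simp add: int_linear_onD(2)[OF q x] algebra_simps)
  qed
qed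

lemma int_linear_on_UNIV_idot:
  fixes a :: "int ^ 'm \<Rightarrow> int"
  assumes a: "int_linear_on UNIV a"
  obtains b where "a = idot b"
proof
  have sum: "a (\<Sum>i\<in>I. f i) = (\<Sum>i\<in>I. a (f i))" if "finite I" for I :: "'m set" and f
    using that
  proof induction
    case empty
    show ?case using int_linear_onD(2)[OF a UNIV_I, of 0 0] by simp
  next
    case (insert i I)
    then show ?case using int_linear_onD(1)[OF a UNIV_I UNIV_I] by simp
  qed
  show "a = idot (\<chi> i. a (axis i 1))"
  proof
    fix x :: "int ^ 'm"
    have "x = (\<Sum>i\<in>UNIV. x $ i *s axis i 1)"
      by (simp add: basis_expansion)
    then have "a x = (\<Sum>i\<in>UNIV. a (x $ i *s axis i 1))"
      using sum[of UNIV "\<lambda>i. x $ i *s axis i 1"] by simp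
    then show "a x = idot (\<chi> i. a (axis i 1)) x"
      using int_linear_onD(2)[OF a UNIV_I] by (simp add: idot_def mult.commute)
  qed
qed

text \<open>The kernel of an integer functional is a direct summand, so functionals on it extend
  integrally, which fails for a sublattice such as the even integers. The equations are dropped one
  at a time.\<close>

lemma int_linear_on_kernels_idot:
  assumes "finite H" and "int_linear_on {x. \<forall>h\<in>H. idot h x = 0} a"
  shows "\<exists>b. \<forall>x. (\<forall>h\<in>H. idot h x = 0) \<longrightarrow> a x = idot b x"
  using assms
proof (induction H arbitrary: a)
  case empty
  then have "int_linear_on UNIV a" by simp
  then obtain b where "a = idot b" by (rule int_linear_on_UNIV_idot)
  then show ?case by auto
next
  case (insert h H)
  define K where "K = {x. \<forall>h\<in>H. idot h x = 0}"
  have K: "lattice_subgroup K" unfolding K_def by (rule lattice_subgroup_kernels)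
  have a: "int_linear_on {x\<in>K. idot h x = 0} a"
    using insert.prems by (simp add: K_def conj_commute)
  obtain g q where "g \<in> K" "int_linear_on K q" "\<forall>x\<in>K. idot h x = q x * idot h g"
    by (rule lattice_subgroup_split[OF K int_linear_on_idot[of K h]])
  then have gq: "g \<in> K" "int_linear_on K q" "\<And>x. x \<in> K \<Longrightarrow> idot h x = q x * idot h g"
    by blast+
  show ?case
  proof (cases "idot h g = 0")
    case True
    have "idot h x = 0" if "x \<in> K" for x using gq(3)[OF that] True by simp
    then have "{x\<in>K. idot h x = 0} = K" by auto
    then obtain b where "\<forall>x. (\<forall>h\<in>H. idot h x = 0) \<longrightarrow> a x = idot b x"
      using insert.IH[of a] a by (auto simp: K_def)
    then show ?thesis by auto
  next
    case False
    \<comment> \<open>The extension gets the value 0 at \<open>g\<close>; it agrees with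
      \<open>a\<close> on the kernel because \<open>q\<close> vanishes there.\<close>
    from insert.IH[OF linear_extension_step[OF K gq a, of 0, unfolded K_def]]
    obtain b where b: "\<forall>x. (\<forall>h\<in>H. idot h x = 0) \<longrightarrow> a (x - q x *s g) + q x * 0 = idot b x"
      by (rule exE)
    have "a x = idot b x" if x: "\<forall>h\<in>insert h H. idot h x = 0" for x
    proof -
      have "q x = 0" using gq(3)[of x] x False by (auto simp: K_def)
      then show ?thesis using b x by (auto simp: vector_smult_lzero)
    qed
    then show ?thesis by blast
  qed
qed

text \<open>On a lattice the one-sided derivative of a sublinear \<open>D\<close> at \<open>g\<close> is a sublinear minorant
  that is linear along \<open>\<int> g\<close>, so differentiating along a basis replaces the Hahn--Banach theorem
  and keeps all values integral.\<close>

lemma sublinear_linear_minorant: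
  fixes K :: "(int ^ 'm) set"
  assumes "finite I" "lattice_subgroup K" "\<And>x i. x \<in> K \<Longrightarrow> i \<notin> I \<Longrightarrow> x $ i = 0" "sublinear_on K D"
  shows "\<exists>a. int_linear_on K a \<and> (\<forall>x\<in>K. a x \<le> D x)"
  using assms
proof (induction I arbitrary: K D)
  case empty
  have K0: "K = {0}" using empty.prems lattice_subgroupD(1)[OF empty.prems(1)] by (auto simp: vec_eq_iff)
  have "D 0 = 0" using sublinear_onD(4)[OF empty.prems(3), of 0 0] K0 by simp
  then show ?case by (intro exI[of _ "\<lambda>_. 0"]) (auto simp: int_linear_on_def K0)
next
  case (insert i I)
  note K = insert.prems(1) and D = insert.prems(3)
  \<comment> \<open>The functional reads off coordinate \<open>i\<close>, so its kernel
    \<open>K'\<close> is supported on \<open>I\<close> and the induction hypothesis applies.\<close>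
  define h :: "int ^ 'm" where "h = axis i 1"
  obtain g q where "g \<in> K" "int_linear_on K q" "\<forall>x\<in>K. idot h x = q x * idot h g"
    by (rule lattice_subgroup_split[OF K int_linear_on_idot[of K h]])
  then have gq: "g \<in> K" "int_linear_on K q" "\<And>x. x \<in> K \<Longrightarrow> idot h x = q x * idot h g"
    by blast+
  define K' where "K' = {x\<in>K. idot h x = 0}"
  have K': "lattice_subgroup K'" unfolding K'_def by (rule lattice_subgroup_kernel[OF K])
  \<comment> \<open>On a group the bound is automatic: subadditivity for
    \<open>(k g + v) + (-v)\<close> bounds the increments below by \<open>- D (-v)\<close>.\<close>
  have bdd: "\<forall>v\<in>K. \<exists>B. \<forall>k. B \<le> D (int k *s g + v) - int k * D g"
  proof (intro ballI exI allI)
    fix v k assume v: "v \<in> K"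
    have nv: "(-1) *s v \<in> K" and kv: "int k *s g + v \<in> K"
      using v gq(1) by (auto intro!: lattice_subgroupD[OF K])
    have "D ((int k *s g + v) + (-1) *s v) \<le> D (int k *s g + v) + D ((-1) *s v)"
      by (rule sublinear_onD(2)[OF D kv nv])
    moreover have "(int k *s g + v) + (-1) *s v = int k *s g" by (simp add: vec_eq_iff)
    ultimately show "- D ((-1) *s v) \<le> D (int k *s g + v) - int k * D g"
      using sublinear_onD(4)[OF D gq(1), of k] by simp
  qed
  obtain E where "sublinear_on {v. \<exists>k. int k *s g + v \<in> K} E" "\<forall>v\<in>K. E v \<le> D v"
    "\<forall>v j. (\<exists>k. int k *s g + v \<in> K) \<longrightarrow> E (j *s g + v) = j * D g + E v"
    by (rule sublinear_derivative[OF D gq(1) bdd])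
  then have E: "sublinear_on {v. \<exists>k. int k *s g + v \<in> K} E"
    "\<And>v. v \<in> K \<Longrightarrow> E v \<le> D v"
    "\<And>v j. (\<exists>k. int k *s g + v \<in> K) \<Longrightarrow> E (j *s g + v) = j * D g + E v"
    by blast+
  have EK: "\<exists>k. int k *s g + v \<in> K" if "v \<in> K" for v
    using that gq(1) by (auto intro!: lattice_subgroupD[OF K])
  have "sublinear_on K' E"
    unfolding sublinear_on_def
  proof (intro conjI ballI allI)
    fix x y assume xy: "x \<in> K'" "y \<in> K'"
    then show "x + y \<in> K'" by (rule lattice_subgroupD(2)[OF K'])
    show "E (x + y) \<le> E x + E y"
      using sublinear_onD(2)[OF E(1), of x y] EK xy by (simp add: K'_def)
  next
    fix x and k :: nat assume x: "x \<in> K'"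
    then show "int k *s x \<in> K'" by (rule lattice_subgroupD(3)[OF K'])
    show "E (int k *s x) = int k * E x"
      using sublinear_onD(4)[OF E(1), of x k] EK x by (simp add: K'_def)
  qed
  moreover have "x $ j = 0" if "x \<in> K'" "j \<notin> I" for x j
    using that insert.prems(2)[of x j] by (cases "j = i") (auto simp: K'_def h_def idot_axis)
  ultimately obtain a where a: "int_linear_on K' a" "\<And>x. x \<in> K' \<Longrightarrow> a x \<le> E x"
    using insert.IH[OF K', of E] by blast
  \<comment> \<open>Linearity of \<open>E\<close> along \<open>g\<close> recombines the two parts:
    the left side is at most \<open>E (q x g + (x - q x g)) = E x \<le> D x\<close>.\<close>
  have "a (x - q x *s g) + q x * D g \<le> D x" if x: "x \<in> K" for x
  proof -
    have mem: "x - q x *s g \<in> K'"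
      using x gq(1) gq(3)[OF x] by (auto simp: K'_def idot_diff idot_scale intro!: lattice_subgroupD[OF K])
    then have "a (x - q x *s g) \<le> E (x - q x *s g)" by (rule a(2))
    moreover have "E (q x *s g + (x - q x *s g)) = q x * D g + E (x - q x *s g)"
      using EK mem by (intro E(3)) (auto simp: K'_def)
    ultimately show ?thesis using E(2)[OF x] by simp
  qed
  then show ?case
    using linear_extension_step[OF K gq a(1)[unfolded K'_def], of "D g"] by blast
qed

section \<open>Dickson's lemma and finite generation\<close>

text \<open>Induction on the coordinates. A set \<open>B\<close> good for \<open>I\<close> also
  serves every \<open>a\<close> whose new coordinate is at least all those of \<open>B\<close>; the
  finitely many smaller values are handled level by level.\<close>

lemma Dickson_finite_minorants:
  fixes w :: "'i \<Rightarrow> 'a \<Rightarrow> nat"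
  assumes "finite I"
  shows "\<exists>B. finite B \<and> B \<subseteq> A \<and> (\<forall>a\<in>A. \<exists>b\<in>B. \<forall>i\<in>I. w i b \<le> w i a)"
  using assms
proof (induction I arbitrary: A)
  case empty
  show ?case
  proof (cases "A = {}")
    case False
    then obtain a where "a \<in> A" by blast
    then show ?thesis by (intro exI[of _ "{a}"]) auto
  qed auto
next
  case (insert i I)
  from insert.IH[of A] obtain B where
    "finite B \<and> B \<subseteq> A \<and> (\<forall>a\<in>A. \<exists>b\<in>B. \<forall>i\<in>I. w i b \<le> w i a)" by (rule exE)
  then have B: "finite B" "B \<subseteq> A" "\<And>a. a \<in> A \<Longrightarrow> \<exists>b\<in>B. \<forall>i\<in>I. w i b \<le> w i a"
    by simp_all
  have "\<forall>j. \<exists>C. finite C \<and> C \<subseteq> {a\<in>A. w i a = j} \<and>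
      (\<forall>a\<in>{a\<in>A. w i a = j}. \<exists>b\<in>C. \<forall>i\<in>I. w i b \<le> w i a)"
    by (intro allI insert.IH)
  then obtain C where "\<forall>j. finite (C j) \<and> C j \<subseteq> {a\<in>A. w i a = j} \<and>
      (\<forall>a\<in>{a\<in>A. w i a = j}. \<exists>b\<in>C j. \<forall>i\<in>I. w i b \<le> w i a)"
    by (rule choice[THEN exE])
  then have C: "\<And>j. finite (C j)" "\<And>j. C j \<subseteq> {a\<in>A. w i a = j}"
    "\<And>j a. a \<in> A \<Longrightarrow> w i a = j \<Longrightarrow> \<exists>b\<in>C j. \<forall>i\<in>I. w i b \<le> w i a"
    by simp_all
  \<comment> \<open>A sum instead of a maximum: it bounds every \<open>w i b\<close> and makes sense
    for empty \<open>B\<close>.\<close>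
  define m where "m = (\<Sum>b\<in>B. w i b)"
  show ?case
  proof (intro exI[of _ "B \<union> (\<Union>j<m. C j)"] conjI ballI)
    show "finite (B \<union> (\<Union>j<m. C j))" using B(1) C(1) by auto
    show "B \<union> (\<Union>j<m. C j) \<subseteq> A" using B(2) C(2) by blast
    fix a assume a: "a \<in> A"
    show "\<exists>b\<in>B \<union> (\<Union>j<m. C j). \<forall>i\<in>insert i I. w i b \<le> w i a"
    proof (cases "w i a < m")
      case True
      obtain b where b: "b \<in> C (w i a)" "\<forall>i\<in>I. w i b \<le> w i a" using C(3)[OF a refl] by (rule bexE)
      then have "w i b = w i a" using C(2) by blast
      then show ?thesis using b True by (intro bexI[of _ b]) auto
    next
      case False
      obtain b where b: "b \<in> B" "\<forall>i\<in>I. w i b \<le> w i a" using B(3)[OF a] by (rule bexE)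
      have "w i b \<le> m" unfolding m_def using b(1) B(1) by (intro member_le_sum) auto
      then show ?thesis using b False by (intro bexI[of _ b]) auto
    qed
  qed
qed

inductive_set generated :: "(int ^ 'm) set \<Rightarrow> (int ^ 'm) set" for B where
  zero: "0 \<in> generated B"
| add: "x \<in> generated B \<Longrightarrow> b \<in> B \<Longrightarrow> x + b \<in> generated B"

text \<open>By Dickson's lemma a nonzero \<open>x\<close> in the cone dominates one of finitely many
  nonzero \<open>b\<close>; then \<open>x - b\<close> lies in the cone and has a smaller sum of
  absolute values.\<close>

lemma Gordan_finitely_generated:
  fixes H :: "(int ^ 'm) set"
  assumes H: "finite H"
  defines "M \<equiv> {x. \<forall>h\<in>H. 0 \<le> idot h x}"
  obtains B where "finite B" "B \<subseteq> M" "M \<subseteq> generated B"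
proof -
  \<comment> \<open>Positive and negative parts of the coordinates are included so that each
    \<open>b $ i\<close> lies between 0 and \<open>x $ i\<close>, and subtraction increases no
    absolute value.\<close>
  define W :: "((int ^ 'm \<Rightarrow> int)) set" where
    "W = idot ` H \<union> range (\<lambda>i x. max 0 (x $ i)) \<union> range (\<lambda>i x. max 0 (- (x $ i)))"
  have "finite W" using H by (simp add: W_def)
  \<comment> \<open>With 0 in the set, \<open>B = {0}\<close> would satisfy the claim; removing it
    guarantees progress in the descent.\<close>
  from Dickson_finite_minorants[OF this, where A = "M - {0}" and w = "\<lambda>f x. nat (f x)"]
  obtain B where "finite B \<and> B \<subseteq> M - {0} \<and>
      (\<forall>a\<in>M - {0}. \<exists>b\<in>B. \<forall>f\<in>W. nat (f b) \<le> nat (f a))"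
    by (elim exE)
  then have B: "finite B" "B \<subseteq> M - {0}"
    "\<And>a. a \<in> M - {0} \<Longrightarrow> \<exists>b\<in>B. \<forall>f\<in>W. nat (f b) \<le> nat (f a)"
    by simp_all
  have "x \<in> generated B" if "x \<in> M" for x
    using that
  proof (induction "nat (\<Sum>i\<in>UNIV. \<bar>x $ i\<bar>)" arbitrary: x rule: less_induct)
    case less
    show ?case
    proof (cases "x = 0")
      case False
      then obtain b where b: "b \<in> B" "\<forall>f\<in>W. nat (f b) \<le> nat (f x)"
        using B(3) less.prems by blast
      have bM: "b \<in> M" and b0: "b \<noteq> 0" using b(1) B(2) by auto
      have "idot h b \<le> idot h x" if "h \<in> H" for h
      proof -
        have "nat (idot h b) \<le> nat (idot h x)" using b(2) that by (auto simp: W_def)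
        then show ?thesis using less.prems bM that by (auto simp: M_def)
      qed
      then have xb: "x - b \<in> M" using bM by (auto simp: M_def idot_diff)
      have le: "\<bar>(x - b) $ i\<bar> = \<bar>x $ i\<bar> - \<bar>b $ i\<bar>" for i
      proof -
        have "nat (max 0 (b $ i)) \<le> nat (max 0 (x $ i))" "nat (max 0 (- (b $ i))) \<le> nat (max 0 (- (x $ i)))"
          using b(2) by (auto simp: W_def)
        then show ?thesis by (simp add: max_def split: if_splits)
      qed
      obtain j where j: "b $ j \<noteq> 0" using b0 by (auto simp: vec_eq_iff)
      have "(\<Sum>i\<in>UNIV. \<bar>(x - b) $ i\<bar>) = (\<Sum>i\<in>UNIV. \<bar>x $ i\<bar>) - (\<Sum>i\<in>UNIV. \<bar>b $ i\<bar>)"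
        unfolding le by (rule sum_subtractf)
      moreover have "(\<Sum>i\<in>UNIV. \<bar>b $ i\<bar>) > 0"
        using j by (intro sum_pos2[of _ j]) auto
      moreover have "(\<Sum>i\<in>UNIV. \<bar>(x - b) $ i\<bar>) \<ge> 0" by (intro sum_nonneg) auto
      ultimately have "x - b \<in> generated B" using xb by (intro less.hyps) auto
      from generated.add[OF this b(1)] show ?thesis by simp
    qed (auto intro: generated.zero)
  qed
  then show thesis using that B by blast
qed

section \<open>Supporting functionals\<close>

text \<open>Take a point in the relative interior of the cone, strictly positive on each constraint
  that is not identically zero on \<open>M\<close>. Its large multiples absorb every
  \<open>v\<close> that obeys the implicit equations.\<close>

lemma cone_order_unit:
  assumes H: "finite H"
  defines "M \<equiv> {x. \<forall>h\<in>H. 0 \<le> idot h x}"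
  obtains c where "c \<in> M"
    "\<forall>v. (\<forall>h\<in>H. (\<forall>x\<in>M. idot h x = 0) \<longrightarrow> idot h v = 0) \<longrightarrow> (\<exists>k. int k *s c + v \<in> M)"
proof -
  \<comment> \<open>A sum of cone points is positive on a constraint as soon as one summand is, so
    one witness per constraint is added up.\<close>
  have "\<exists>c\<in>M. \<forall>h\<in>J. (\<exists>x\<in>M. 0 < idot h x) \<longrightarrow> 0 < idot h c" if "finite J" "J \<subseteq> H" for J
    using that
  proof (induction J)
    case empty
    have "0 \<in> M" by (simp add: M_def idot_zero)
    then show ?case by blast
  next
    case (insert h J)
    then obtain c where c: "c \<in> M" "\<And>h. h \<in> J \<Longrightarrow> \<exists>x\<in>M. 0 < idot h x \<Longrightarrow> 0 < idot h c" by blast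
    show ?case
    proof (cases "\<exists>x\<in>M. 0 < idot h x")
      case True
      then obtain x where x: "x \<in> M" "0 < idot h x" by blast
      have nn: "0 \<le> idot g c" "0 \<le> idot g x" if "g \<in> H" for g using that c(1) x(1) by (auto simp: M_def)
      have "c + x \<in> M" using nn by (auto simp: M_def idot_add)
      moreover have "0 < idot g (c + x)" if "g \<in> insert h J" "\<exists>x\<in>M. 0 < idot g x" for g
        using that nn[of g] c(2)[of g] x(2) insert.prems by (auto simp: idot_add add_nonneg_pos add_pos_nonneg)
      ultimately show ?thesis by blast
    qed (use c in blast)
  qed
  from this[OF H order_refl] obtain c where c: "c \<in> M"
    "\<And>h. h \<in> H \<Longrightarrow> \<exists>x\<in>M. 0 < idot h x \<Longrightarrow> 0 < idot h c" by blast
  have "\<exists>k. int k *s c + v \<in> M"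
    if v: "\<forall>h\<in>H. (\<forall>x\<in>M. idot h x = 0) \<longrightarrow> idot h v = 0" for v
  proof
    define k where "k = (\<Sum>h\<in>H. nat \<bar>idot h v\<bar>)"
    have "0 \<le> idot h (int k *s c + v)" if h: "h \<in> H" for h
    proof (cases "\<forall>x\<in>M. idot h x = 0")
      case True
      then show ?thesis using v h c(1) by (simp add: idot_add idot_scale)
    next
      case False
      moreover have "0 \<le> idot h x" if "x \<in> M" for x using that h by (simp add: M_def)
      ultimately have "\<exists>x\<in>M. 0 < idot h x" by force
      then have "0 < idot h c" by (rule c(2)[OF h])
      then have "int k * 1 \<le> int k * idot h c" by (intro mult_left_mono) auto
      moreover have "nat \<bar>idot h v\<bar> \<le> k" unfolding k_def using h H by (intro member_le_sum) auto
      ultimately show ?thesis by (simp add: idot_add idot_scale)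
    qed
    then show "int k *s c + v \<in> M" by (simp add: M_def)
  qed
  then show thesis using that c(1) by blast
qed

text \<open>The derivative at \<open>c\<close> is linear along \<open>c\<close>, which forces
  contact there; the second derivative, at an order unit \<open>e\<close>, is defined on a lattice,
  where a linear minorant exists.\<close>

lemma sublinear_supporting_functional:
  fixes H :: "(int ^ 'm) set"
  assumes H: "finite H"
  defines "M \<equiv> {x. \<forall>h\<in>H. 0 \<le> idot h x}"
  assumes F: "sublinear_on M F" and c: "c \<in> M"
    and bdd: "\<forall>v\<in>M. \<exists>B. \<forall>k. B \<le> F (int k *s c + v) - int k * F c"
  shows "\<exists>a. (\<forall>x\<in>M. idot a x \<le> F x) \<and> idot a c = F c"
proof -
  \<comment> \<open>\<open>H0\<close> collects the implicit equations of the cone; \<open>G\<close>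
    is then the group of differences of elements of \<open>M\<close>.\<close>
  define H0 where "H0 = {h\<in>H. \<forall>x\<in>M. idot h x = 0}"
  define G where "G = {x. \<forall>h\<in>H0. idot h x = 0}"
  have G: "lattice_subgroup G" unfolding G_def by (rule lattice_subgroup_kernels)
  have MG: "M \<subseteq> G" by (auto simp: G_def H0_def)
  obtain e where e: "e \<in> M" and "\<forall>v. (\<forall>h\<in>H. (\<forall>x\<in>M. idot h x = 0) \<longrightarrow> idot h v = 0) \<longrightarrow> (\<exists>k. int k *s e + v \<in> M)"
    unfolding M_def by (rule cone_order_unit[OF H])
  then have unit: "\<exists>k. int k *s e + v \<in> M" if "v \<in> G" for v
    using that by (auto simp: G_def H0_def)
  define M1 where "M1 = {v. \<exists>k. int k *s c + v \<in> M}"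
  obtain D where D: "sublinear_on M1 D" "\<forall>v\<in>M. D v \<le> F v"
    "\<forall>v j. v \<in> M1 \<longrightarrow> D (j *s c + v) = j * F c + D v"
    by (rule sublinear_derivative[OF F c bdd]) (simp add: M1_def)
  have MM1: "M \<subseteq> M1" by (auto simp: M1_def intro!: exI[of _ 0])
  have M1G: "M1 \<subseteq> G"
  proof
    fix v assume "v \<in> M1"
    then obtain k where k: "int k *s c + v \<in> M" by (auto simp: M1_def)
    then have "(int k *s c + v) - int k *s c \<in> G" using MG c by (intro lattice_subgroupD(4)[OF G _ lattice_subgroupD(3)[OF G]]) auto
    then show "v \<in> G" by simp
  qed
  have e1: "e \<in> M1" using e MM1 by blast
  \<comment> \<open>With \<open>N e - v\<close> in the cone, the decomposition
    \<open>(k + N) e = (k e + v) + (N e - v)\<close> bounds the increments of \<open>D\<close> from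
    below.\<close>
  have bdd1: "\<forall>v\<in>M1. \<exists>B. \<forall>k. B \<le> D (int k *s e + v) - int k * D e"
  proof
    fix v assume v: "v \<in> M1"
    have "(-1) *s v \<in> G" using v M1G by (intro lattice_subgroupD[OF G]) auto
    then obtain N where "int N *s e + (-1) *s v \<in> M" using unit by blast
    then have N: "int N *s e + (-1) *s v \<in> M1" using MM1 by blast
    have "int N * D e - D (int N *s e + (-1) *s v) \<le> D (int k *s e + v) - int k * D e" for k
    proof -
      have "int k *s e + v \<in> M1"
        using sublinear_onD(1)[OF D(1) sublinear_onD(3)[OF D(1) e1] v] .
      then have "D ((int k *s e + v) + (int N *s e + (-1) *s v))
          \<le> D (int k *s e + v) + D (int N *s e + (-1) *s v)"
        by (rule sublinear_onD(2)[OF D(1) _ N])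
      moreover have "(int k *s e + v) + (int N *s e + (-1) *s v) = int (k + N) *s e"
        by (simp add: vec_eq_iff algebra_simps)
      ultimately have "D (int (k + N) *s e) \<le> D (int k *s e + v) + D (int N *s e + (-1) *s v)"
        by (simp only:)
      moreover have "D (int (k + N) *s e) = int k * D e + int N * D e"
        unfolding sublinear_onD(4)[OF D(1) e1] by (simp add: algebra_simps)
      ultimately show ?thesis by linarith
    qed
    then show "\<exists>B. \<forall>k. B \<le> D (int k *s e + v) - int k * D e" by blast
  qed
  obtain E where E: "sublinear_on {v. \<exists>k. int k *s e + v \<in> M1} E" "\<forall>v\<in>M1. E v \<le> D v"
    by (rule sublinear_derivative[OF D(1) e1 bdd1])
  have "{v. \<exists>k. int k *s e + v \<in> M1} = G"
  proof (intro equalityI subsetI)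
    fix v assume "v \<in> {v. \<exists>k. int k *s e + v \<in> M1}"
    then obtain k where k: "int k *s e + v \<in> M1" by blast
    then have "(int k *s e + v) - int k *s e \<in> G" using MG M1G e by (intro lattice_subgroupD(4)[OF G _ lattice_subgroupD(3)[OF G]]) auto
    then show "v \<in> G" by simp
  qed (use unit MM1 in blast)
  with E(1) have "sublinear_on G E" by simp
  from sublinear_linear_minorant[OF finite_class.finite_UNIV G _ this]
  obtain a where a: "int_linear_on G a" "\<forall>x\<in>G. a x \<le> E x" by auto
  have "finite H0" using H by (simp add: H0_def)
  from int_linear_on_kernels_idot[OF this a(1)[unfolded G_def]]
  obtain b where b: "\<And>x. x \<in> G \<Longrightarrow> a x = idot b x" by (auto simp: G_def)
  have bD: "idot b x \<le> D x" if "x \<in> M1" for x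
  proof -
    have "x \<in> G" using that M1G by blast
    then show ?thesis using a(2) b E(2) that by fastforce
  qed
  \<comment> \<open>For the reverse inequality the minorant is evaluated at \<open>-c\<close>, where
    \<open>D (-c) = - F c + D 0\<close> and \<open>D 0 \<le> 0\<close>.\<close>
  have "idot b c = F c"
  proof (rule antisym)
    show "idot b c \<le> F c" using bD[of c] c MM1 D(2) by fastforce
    have zero: "0 \<in> M" by (simp add: M_def idot_zero)
    have "D 0 \<le> F 0" using D(2) zero by blast
    then have "D 0 \<le> 0" using sublinear_onD(4)[OF F c, of 0] by simp
    moreover have "int 1 *s c + (-1) *s c = 0" by (simp add: vec_eq_iff)
    then have "(-1) *s c \<in> M1" unfolding M1_def using zero by (metis (mono_tags) mem_Collect_eq)
    then have "- idot b c \<le> D ((-1) *s c)" using bD[of "(-1) *s c"] by (simp add: idot_scale)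
    moreover have "D ((-1) *s c + 0) = (-1) * F c + D 0" using D(3) zero MM1 by blast
    ultimately show "F c \<le> idot b c" by simp
  qed
  moreover have "idot b x \<le> F x" if "x \<in> M" for x
    using bD[of x] that MM1 D(2) by fastforce
  ultimately show ?thesis by blast
qed

text \<open>If the gaps of \<open>a'\<close> below \<open>F\<close> at the generators are no larger
  than those of \<open>a\<close>, then \<open>a \<le> a'\<close> on \<open>M\<close> by additivity,
  so \<open>a'\<close> touches \<open>F\<close> wherever \<open>a\<close> does. Dickson's lemma
  selects finitely many such \<open>a'\<close>.\<close>

lemma finitely_many_supporting_functionals:
  fixes H :: "(int ^ 'm) set"
  assumes H: "finite H"
  defines "M \<equiv> {x. \<forall>h\<in>H. 0 \<le> idot h x}"
  assumes supp: "\<And>c. c \<in> M \<Longrightarrow> \<exists>a. (\<forall>x\<in>M. idot a x \<le> F x) \<and> idot a c = F c"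
  obtains L where "finite L" "\<forall>a\<in>L. \<forall>x\<in>M. idot a x \<le> F x" "\<forall>x\<in>M. \<exists>a\<in>L. idot a x = F x"
proof -
  obtain B where B: "finite B" "B \<subseteq> M" "M \<subseteq> generated B"
    unfolding M_def by (rule Gordan_finitely_generated[OF H])
  define A where "A = {a. \<forall>x\<in>M. idot a x \<le> F x}"
  from Dickson_finite_minorants[OF B(1), where A = A and w = "\<lambda>b a. nat (F b - idot a b)"]
  obtain L where "finite L \<and> L \<subseteq> A \<and>
      (\<forall>a\<in>A. \<exists>a'\<in>L. \<forall>b\<in>B. nat (F b - idot a' b) \<le> nat (F b - idot a b))" by (rule exE)
  then have L: "finite L" "L \<subseteq> A"
    "\<And>a. a \<in> A \<Longrightarrow> \<exists>a'\<in>L. \<forall>b\<in>B. nat (F b - idot a' b) \<le> nat (F b - idot a b)" by simp_all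
  have "\<exists>a\<in>L. idot a x = F x" if x: "x \<in> M" for x
  proof -
    obtain a where a: "a \<in> A" "idot a x = F x" using supp[OF x] by (auto simp: A_def)
    obtain a' where a': "a' \<in> L" "\<forall>b\<in>B. nat (F b - idot a' b) \<le> nat (F b - idot a b)"
      using L(3)[OF a(1)] by (rule bexE)
    have le: "idot a b \<le> idot a' b" if "b \<in> B" for b
    proof -
      have "idot a b \<le> F b" using that a(1) B(2) by (auto simp: A_def)
      moreover have "nat (F b - idot a' b) \<le> nat (F b - idot a b)" using a'(2) that by blast
      ultimately show ?thesis by simp
    qed
    have "idot a y \<le> idot a' y" if "y \<in> generated B" for y
      using that
    proof induction
      case (add y b)
      then show ?case using le[of b] by (simp add: idot_add)
    qed (simp add: idot_zero)
    then have "idot a x \<le> idot a' x" using x B(3) by blast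
    moreover have "idot a' x \<le> F x" using a'(1) L(2) x by (auto simp: A_def)
    ultimately show ?thesis using a' a(2) by (intro bexI[of _ a']) auto
  qed
  moreover have "\<forall>a\<in>L. \<forall>x\<in>M. idot a x \<le> F x" using L(2) by (auto simp: A_def)
  ultimately show thesis using that[of L] L(1) by blast
qed

section \<open>Rational segments\<close>

lemma common_denominator:
  fixes f :: "'i \<Rightarrow> real"
  assumes "finite I" "\<And>i. i \<in> I \<Longrightarrow> f i \<in> \<rat>"
  shows "\<exists>d::int. d > 0 \<and> (\<forall>i\<in>I. of_int d * f i \<in> \<int>)"
  using assms
proof (induction I)
  case empty
  show ?case by (intro exI[of _ 1]) simp
next
  case (insert i I)
  then obtain d :: int where d: "d > 0" "\<forall>i\<in>I. of_int d * f i \<in> \<int>" by auto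
  obtain e a :: int where e: "e > 0" "f i = of_int a / of_int e"
    using insert.prems[of i] by (auto elim: Rats_cases')
  have "of_int (d * e) * f j \<in> \<int>" if "j \<in> insert i I" for j
  proof (cases "j = i")
    case True
    have "of_int (d * e) * f i = of_int (d * a)" using e by simp
    then show ?thesis using True by (metis Ints_of_int)
  next
    case False
    then have "of_int d * f j \<in> \<int>" using d that by blast
    then have "of_int e * (of_int d * f j) \<in> \<int>" by (rule Ints_mult[OF Ints_of_int])
    moreover have "of_int (d * e) * f j = of_int e * (of_int d * f j)" by simp
    ultimately show ?thesis by (simp only:)
  qed
  then show ?case using d(1) e(1) by (intro exI[of _ "d * e"]) simp
qed

lemma of_int_floor_Ints: "r \<in> \<int> \<Longrightarrow> of_int \<lfloor>r\<rfloor> = r"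
  by (metis Ints_cases floor_of_int)

lemma rational_halfspace_inner:
  fixes a :: "real ^ 'n"
  assumes a: "a \<in> rational_points" "a \<noteq> 0" and b: "b \<in> \<rat>"
  shows "rational_halfspace {x. inner a x + b \<ge> 0}"
proof -
  \<comment> \<open>The constant term joins the coefficients as the \<open>None\<close> entry of one
    family, so a single denominator clears all of them.\<close>
  have "case_option b (($) a) i \<in> \<rat>" for i
    using a b by (auto simp: rational_points_def split: option.split)
  then obtain d :: int where d: "d > 0" "\<And>i. of_int d * case_option b (($) a) i \<in> \<int>"
    using common_denominator[of "UNIV :: 'n option set" "case_option b (($) a)"] by auto
  define a' :: "int ^ 'n" where "a' = (\<chi> i. \<lfloor>of_int d * a $ i\<rfloor>)"
  define b' where "b' = \<lfloor>of_int d * b\<rfloor>"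
  have a': "of_int (a' $ i) = of_int d * a $ i" for i
    unfolding a'_def vec_lambda_beta
    by (rule of_int_floor_Ints[OF d(2)[of "Some i", unfolded option.case]])
  have b': "of_int b' = of_int d * b"
    unfolding b'_def by (rule of_int_floor_Ints[OF d(2)[of None, unfolded option.case]])
  have eq: "int_affine a' b' x = of_int d * (inner a x + b)" for x
    by (simp add: int_affine_def a' b' inner_vec_def sum_distrib_left distrib_left mult_ac)
  obtain i where i: "a $ i \<noteq> 0" using a(2) by (auto simp: vec_eq_iff)
  have "a' \<noteq> 0" using a'[of i] i d(1) by auto
  moreover have "{x. inner a x + b \<ge> 0} = {x. int_affine a' b' x \<ge> 0}"
    using d(1) by (simp add: eq zero_le_mult_iff)
  ultimately show ?thesis unfolding rational_halfspace_def by blast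
qed

text \<open>If the endpoints differ in coordinate \<open>i\<close>, their line has the rational
  equations \<open>d_i (x_j - u_j) = d_j (x_i - u_i)\<close>, each a pair of opposite halfspaces,
  and bounds on \<open>x_i\<close> cut out the segment.\<close>

lemma rational_line_segmentI:
  fixes u v :: "real ^ 'n"
  assumes uv: "u \<in> rational_points" "v \<in> rational_points" "u \<noteq> v"
  shows "rational_line_segment (closed_segment u v)"
proof -
  have "rational_polyhedral (closed_segment u v)"
    if uv: "u \<in> rational_points" "v \<in> rational_points" and i: "u $ i < v $ i" for u v :: "real ^ 'n" and i
  proof -
    define d where "d = v - u"
    have rat: "u $ j \<in> \<rat>" "v $ j \<in> \<rat>" "d $ j \<in> \<rat>" for j
      using uv by (auto simp: rational_points_def d_def)
    have di: "d $ i > 0" using i by (simp add: d_def)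
    \<comment> \<open>Normal vector of the equation linking coordinates \<open>j\<close> and
      \<open>i\<close>; its entry \<open>j\<close> is \<open>d $ i > 0\<close>, so it is nonzero as
      a halfspace requires.\<close>
    define n where "n j = (\<chi> l. if l = j then d $ i else if l = i then - (d $ j) else 0)" for j
    have n: "inner (n j) x = d $ i * x $ j - d $ j * x $ i" if "j \<noteq> i" for j x
    proof -
      have "inner (n j) x = (\<Sum>l\<in>UNIV. (if l = j then d $ i * x $ l else 0) - (if l = i then d $ j * x $ l else 0))"
        unfolding inner_vec_def n_def using that by (intro sum.cong) auto
      then show ?thesis by (simp add: sum_subtractf)
    qed
    have nrat: "n j \<in> rational_points" "- n j \<in> rational_points" for j
      using rat by (auto simp: rational_points_def n_def)
    have n0: "n j \<noteq> 0" for j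
    proof
      assume "n j = 0"
      then have "n j $ j = 0" by simp
      then show False using di by (simp add: n_def)
    qed
    define hs where "hs a b = {x. inner a x + b \<ge> (0::real)}" for a :: "real ^ 'n" and b
    define \<H> where "\<H> = {hs (axis i 1) (- (u $ i)), hs (- axis i 1) (v $ i)} \<union>
      (\<lambda>j. hs (n j) (- (inner (n j) u))) ` (- {i}) \<union> (\<lambda>j. hs (- n j) (inner (n j) u)) ` (- {i})"
    have hs: "rational_halfspace (hs a b)" if "a \<in> rational_points" "a \<noteq> 0" "b \<in> \<rat>" for a b
      unfolding hs_def by (rule rational_halfspace_inner[OF that])
    have "rational_halfspace X" if "X \<in> \<H>" for X
    proof -
      have ax: "axis i 1 \<in> rational_points" "- axis i 1 \<in> (rational_points :: (real ^ 'n) set)" "axis i (1::real) \<noteq> 0"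
        by (auto simp: rational_points_def axis_def vec_eq_iff)
      have "inner (n j) u \<in> \<rat>" if "j \<noteq> i" for j using n[OF that] rat by simp
      then have "rational_halfspace (hs (n j) (- (inner (n j) u)))" "rational_halfspace (hs (- n j) (inner (n j) u))"
        if "j \<noteq> i" for j
        using that nrat n0 by (auto intro!: hs)
      moreover have "rational_halfspace (hs (axis i 1) (- (u $ i)))" "rational_halfspace (hs (- axis i 1) (v $ i))"
        using ax rat by (auto intro!: hs)
      ultimately show ?thesis
        using that by (auto simp: \<H>_def)
    qed
    moreover have "closed_segment u v = \<Inter>\<H>"
    proof (intro equalityI subsetI)
      fix x assume "x \<in> closed_segment u v"
      then obtain t where t: "0 \<le> t" "t \<le> 1" "x = u + t *\<^sub>R d"
        by (auto simp: closed_segment_def d_def algebra_simps)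
      have "inner (n j) x = inner (n j) u" if "j \<noteq> i" for j
        using that by (simp add: n t(3) algebra_simps)
      moreover have "u $ i \<le> x $ i" using t di by simp
      moreover have "x $ i \<le> v $ i"
      proof -
        have "t * d $ i \<le> 1 * d $ i" using t di by (intro mult_right_mono) auto
        then show ?thesis using t by (simp add: d_def)
      qed
      ultimately show "x \<in> \<Inter>\<H>" by (auto simp: \<H>_def hs_def inner_axis')
    next
      fix x assume x: "x \<in> \<Inter>\<H>"
      then have xi: "u $ i \<le> x $ i" "x $ i \<le> v $ i" by (auto simp: \<H>_def hs_def inner_axis')
      have j: "inner (n j) x = inner (n j) u" if "j \<noteq> i" for j
      proof (rule antisym)
        have "hs (n j) (- (inner (n j) u)) \<in> \<H>" "hs (- n j) (inner (n j) u) \<in> \<H>"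
          using that by (auto simp: \<H>_def)
        then have "x \<in> hs (n j) (- (inner (n j) u))" "x \<in> hs (- n j) (inner (n j) u)" using x by blast+
        then show "inner (n j) x \<le> inner (n j) u" "inner (n j) u \<le> inner (n j) x"
          by (auto simp: hs_def)
      qed
      \<comment> \<open>The parameter is read off coordinate \<open>i\<close>; the equations then
        fix the other coordinates.\<close>
      define t where "t = (x $ i - u $ i) / d $ i"
      have "0 \<le> t" "t \<le> 1" using xi di by (auto simp: t_def d_def)
      moreover have "x = u + t *\<^sub>R d"
      proof (subst vec_eq_iff, intro allI)
        fix l
        show "x $ l = (u + t *\<^sub>R d) $ l"
        proof (cases "l = i")
          case False
          then show ?thesis using j[of l] n[of l x] n[of l u] di by (simp add: t_def field_simps)
        qed (use di in \<open>simp add: t_def\<close>)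
      qed
      ultimately show "x \<in> closed_segment u v"
        by (auto simp: closed_segment_def d_def algebra_simps intro!: exI[of _ t])
    qed
    moreover have "finite \<H>" by (simp add: \<H>_def)
    ultimately show ?thesis unfolding rational_polyhedral_def by blast
  qed
  note pos = this
  obtain i where "u $ i \<noteq> v $ i" using uv(3) by (auto simp: vec_eq_iff)
  \<comment> \<open>The construction assumed \<open>u $ i < v $ i\<close>; otherwise the endpoints
    are exchanged.\<close>
  then have "rational_polyhedral (closed_segment u v)"
    using pos[OF uv(1,2), of i] pos[OF uv(2,1), of i] by (auto simp: closed_segment_commute neq_iff)
  then show ?thesis using uv(3) unfolding rational_line_segment_def by blast
qed

section \<open>Homogenisation\<close>

text \<open>Were every step strict, integrality would give slope at most -1, against the limit 0. So
  some step is flat, and by convexity all later steps are nonnegative: the minimum is reached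
  there.\<close>

lemma convex_antimono_int_bounded_below:
  fixes m :: "nat \<Rightarrow> int"
  assumes dec: "\<And>k. m (Suc k) \<le> m k"
    and conv: "\<And>k. 2 * m (Suc k) \<le> m k + m (Suc (Suc k))"
    and lim: "(\<lambda>k. of_int (m k) / real k) \<longlonglongrightarrow> 0"
  shows "\<exists>B. \<forall>k. B \<le> m k"
proof -
  have "\<exists>K. m (Suc K) = m K"
  proof (rule ccontr)
    assume "\<not> ?thesis"
    then have step: "m (Suc k) \<le> m k - 1" for k using dec[of k] by (metis order_le_less zle_diff1_eq)
    have le: "m k \<le> m 0 - int k" for k
    proof (induction k)
      case (Suc k)
      then show ?case using step[of k] by simp
    qed simp
    have "(\<lambda>k. of_int (m 0) * inverse (real k) - 1) \<longlonglongrightarrow> of_int (m 0) * 0 - 1"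
      by (intro tendsto_intros lim_inverse_n)
    moreover have "of_int (m k) / real k \<le> of_int (m 0) * inverse (real k) - 1" if "k \<ge> 1" for k
    proof -
      have "(of_int (m k) :: real) \<le> of_int (m 0 - int k)" using le[of k] by (subst of_int_le_iff)
      then have "of_int (m k) / real k \<le> (of_int (m 0) - real k) / real k" by (intro divide_right_mono) auto
      also have "\<dots> = of_int (m 0) * inverse (real k) - 1" using that by (simp add: field_simps)
      finally show ?thesis .
    qed
    ultimately have "0 \<le> of_int (m 0) * (0::real) - 1"
      using lim by (intro LIMSEQ_le[of "\<lambda>k. of_int (m k) / real k" _ "\<lambda>k. of_int (m 0) * inverse (real k) - 1"]) auto
    then show False by simp
  qed
  then obtain K where K: "m (Suc K) = m K" by blast
  have "m K \<le> m (K + j) \<and> m (K + j) \<le> m (Suc (K + j))" for j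
  proof (induction j)
    case (Suc j)
    then show ?case using conv[of "K + j"] by simp
  qed (simp add: K)
  moreover have "decseq m" using dec by (simp add: decseq_Suc_iff)
  ultimately have "m K \<le> m k" for k by (metis decseqD le_add_diff_inverse nle_le)
  then show ?thesis by blast
qed

section \<open>Homogeneous coordinates, with \<open>None\<close> indexing the extra one\<close>

definition homogenize :: "int ^ 'n \<Rightarrow> int \<Rightarrow> int ^ ('n option)" where
  "homogenize a b = (\<chi> j. case j of None \<Rightarrow> b | Some i \<Rightarrow> a $ i)"

text \<open>Entry \<open>None\<close> is the common denominator. Where it is 0, division yields the
  vector 0, and the value of \<open>f\<close> there will be multiplied by that zero entry.\<close>

definition dehomogenize :: "int ^ ('n option) \<Rightarrow> real ^ 'n" where
  "dehomogenize p = (\<chi> i. of_int (p $ Some i) / of_int (p $ None))"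

lemma homogenize_surj: "homogenize (\<chi> i. p $ Some i) (p $ None) = p"
  by (simp add: homogenize_def vec_eq_iff split: option.split)

lemma idot_homogenize:
  "idot (homogenize a b) p = (\<Sum>i\<in>UNIV. a $ i * p $ Some i) + b * p $ None"
  by (simp add: idot_def homogenize_def UNIV_option_conv sum.reindex)

lemma int_affine_dehomogenize:
  assumes "p $ None > 0"
  shows "of_int (idot (homogenize a b) p) = of_int (p $ None) * int_affine a b (dehomogenize p)"
  using assms
  by (simp add: idot_homogenize int_affine_def dehomogenize_def distrib_left sum_distrib_left)

lemma dehomogenize_rational: "dehomogenize p \<in> rational_points"
  by (simp add: rational_points_def dehomogenize_def)

lemma dehomogenize_scale: "k \<noteq> 0 \<Longrightarrow> dehomogenize (k *s p) = dehomogenize p"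
  by (simp add: dehomogenize_def vec_eq_iff)

text \<open>The weights are rational and proportional to the denominators; this turns Q-convexity of
  \<open>f\<close> into subadditivity of its homogenisation.\<close>

lemma dehomogenize_add:
  assumes "p $ None > 0" "q $ None > 0"
  shows "dehomogenize (p + q) =
    (of_int (p $ None) / of_int (p $ None + q $ None)) *\<^sub>R dehomogenize p +
    (1 - of_int (p $ None) / of_int (p $ None + q $ None)) *\<^sub>R dehomogenize q"
proof -
  have "1 - s / (s + t) = t / (s + t)" if "s > 0" "t > 0" for s t :: real
    using that by (simp add: field_simps)
  then show ?thesis
    using assms by (simp add: dehomogenize_def vec_eq_iff add_divide_distrib)
qed

lemma dehomogenize_rational_points:
  fixes x :: "real ^ 'n"
  assumes "x \<in> rational_points"
  obtains p where "p $ None > 0" "dehomogenize p = x"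
proof -
  obtain d :: int where d: "d > 0" "\<And>i. of_int d * x $ i \<in> \<int>"
    using common_denominator[of "UNIV :: 'n set" "($) x"] assms by (auto simp: rational_points_def)
  have "dehomogenize (homogenize (\<chi> i. \<lfloor>of_int d * x $ i\<rfloor>) d) = x"
    using d(1) by (simp add: dehomogenize_def homogenize_def vec_eq_iff of_int_floor_Ints[OF d(2)])
  then show thesis using d(1) by (intro that) (auto simp: homogenize_def)
qed

lemma int_affine_line:
  "int_affine a b (x + t *\<^sub>R y) = int_affine a b x + t * (\<Sum>i\<in>UNIV. of_int (a $ i) * y $ i)"
  by (simp add: int_affine_def algebra_simps sum.distrib sum_distrib_left)

lemma rational_polyhedral_int_affine:
  assumes "rational_polyhedral S"
  obtains C where "finite C" "S = {x. \<forall>(a, b)\<in>C. int_affine a b x \<ge> 0}"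
proof -
  obtain \<H> where \<H>: "finite \<H>" "\<forall>X\<in>\<H>. rational_halfspace X" "S = \<Inter>\<H>"
    using assms by (auto simp: rational_polyhedral_def)
  have "\<forall>X\<in>\<H>. \<exists>c. X = {x. int_affine (fst c) (snd c) x \<ge> 0}"
  proof
    fix X assume "X \<in> \<H>"
    then obtain a b where "X = {x. int_affine a b x \<ge> 0}"
      using \<H>(2) unfolding rational_halfspace_def by blast
    then show "\<exists>c. X = {x. int_affine (fst c) (snd c) x \<ge> 0}" by (intro exI[of _ "(a, b)"]) simp
  qed
  from bchoice[OF this] obtain g where g: "\<forall>X\<in>\<H>. X = {x. int_affine (fst (g X)) (snd (g X)) x \<ge> 0}"
    by blast
  have "S = {x. \<forall>(a, b)\<in>g ` \<H>. int_affine a b x \<ge> 0}"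
    unfolding \<H>(3) using g by (auto simp: case_prod_beta)
  then show thesis using \<H>(1) by (intro that[of "g ` \<H>"]) auto
qed

text \<open>The points of \<open>k p + q\<close> move along the segment from that of
  \<open>q\<close> towards that of \<open>p\<close>, so continuity there makes the increments
  \<open>o(k)\<close>; they are also nonincreasing and convex in \<open>k\<close>.\<close>

lemma increment_bounded_below:
  assumes F: "sublinear_on M F" and pq: "p \<in> M" "q \<in> M" "p $ None > 0" "q $ None > 0"
    and Ff: "\<forall>p\<in>M. real_of_int (F p) = of_int (p $ None) * f (dehomogenize p)"
    and cont: "continuous_on (closed_segment (dehomogenize p) (dehomogenize q) \<inter> rational_points) f"
  shows "\<exists>B. \<forall>k. B \<le> F (int k *s p + q) - int k * F p"
proof (rule convex_antimono_int_bounded_below)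
  have mem: "int k *s p + q \<in> M" for k
    using sublinear_onD(1)[OF F sublinear_onD(3)[OF F pq(1)] pq(2)] .
  have step: "p + (int k *s p + q) = int (Suc k) *s p + q" for k
    by (simp add: vec_eq_iff algebra_simps)
  show "F (int (Suc k) *s p + q) - int (Suc k) * F p \<le> F (int k *s p + q) - int k * F p" for k
    using sublinear_onD(2)[OF F pq(1) mem, of k] unfolding step by (simp add: algebra_simps)
  \<comment> \<open>Twice the middle term is the sum of its neighbours, so subadditivity and
    homogeneity give convexity in \<open>k\<close>.\<close>
  have dbl: "(int k *s p + q) + (int (Suc (Suc k)) *s p + q) = int 2 *s (int (Suc k) *s p + q)" for k
    by (simp add: vec_eq_iff algebra_simps)
  show "2 * (F (int (Suc k) *s p + q) - int (Suc k) * F p)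
      \<le> F (int k *s p + q) - int k * F p + (F (int (Suc (Suc k)) *s p + q) - int (Suc (Suc k)) * F p)" for k
  proof -
    have "F (int 2 *s (int (Suc k) *s p + q)) \<le> F (int k *s p + q) + F (int (Suc (Suc k)) *s p + q)"
      unfolding dbl[symmetric] by (rule sublinear_onD(2)[OF F mem mem])
    then have "2 * F (int (Suc k) *s p + q) \<le> F (int k *s p + q) + F (int (Suc (Suc k)) *s p + q)"
      unfolding sublinear_onD(4)[OF F mem] by simp
    moreover have "2 * (int (Suc k) * F p) = int k * F p + int (Suc (Suc k)) * F p"
      by (simp add: algebra_simps)
    moreover have "2 * (x - c) \<le> y - b + (z - d)" if "2 * x \<le> y + z" "2 * c = b + d"
      for x y z b c d :: int using that unfolding right_diff_distrib by presburger
    ultimately show ?thesis by blast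
  qed
  define s t where "s = real_of_int (p $ None)" and "t = real_of_int (q $ None)"
  have st: "s > 0" "t > 0" using pq by (auto simp: s_def t_def)
  define x y where "x = dehomogenize p" and "y = dehomogenize q"
  define z where "z k = dehomogenize (int k *s p + q)" for k
  have pos: "t + s * real k > 0" for k using st by (simp add: add_pos_nonneg)
  \<comment> \<open>The weight of the endpoint \<open>y\<close> is \<open>t / (t + s k)\<close>,
    which tends to 0.\<close>
  have zx: "z k = x + (t / (t + s * real k)) *\<^sub>R (y - x)" for k
  proof -
    have "(real k * a + b) / (real k * s + t) = a / s + t / (t + s * real k) * (b / t - a / s)" for a b
    proof -
      have "(real k * a + b) / (t + s * real k) = a / s + t / (t + s * real k) * (b / t - a / s)"
        using st pos[of k] by (simp add: divide_simps) (simp add: algebra_simps)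
      then show ?thesis by (simp add: add.commute mult.commute)
    qed
    then show ?thesis
      by (simp add: vec_eq_iff z_def x_def y_def dehomogenize_def s_def t_def)
  qed
  have "filterlim (\<lambda>k. t + s * real k) at_top sequentially"
    by (intro filterlim_tendsto_add_at_top[OF tendsto_const]
        filterlim_tendsto_pos_mult_at_top[OF tendsto_const st(1)] filterlim_real_sequentially)
  then have "(\<lambda>k. t / (t + s * real k)) \<longlonglongrightarrow> 0"
    by (intro tendsto_divide_0[OF tendsto_const] filterlim_at_top_imp_at_infinity)
  then have "(\<lambda>k. x + (t / (t + s * real k)) *\<^sub>R (y - x)) \<longlonglongrightarrow> x + 0 *\<^sub>R (y - x)"
    by (intro tendsto_intros)
  then have "z \<longlonglongrightarrow> x" by (simp add: zx[abs_def])
  moreover have "z k \<in> closed_segment x y \<inter> rational_points" for k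
  proof -
    have "0 \<le> t / (t + s * real k)" "t / (t + s * real k) \<le> 1" using st pos[of k] by auto
    then have "z k \<in> closed_segment x y"
      unfolding zx closed_segment_def by (auto intro!: exI[of _ "t / (t + s * real k)"] simp: algebra_simps)
    then show ?thesis by (simp add: z_def dehomogenize_rational)
  qed
  moreover have "x \<in> closed_segment x y \<inter> rational_points" by (simp add: x_def dehomogenize_rational)
  ultimately have "(\<lambda>k. f (z k)) \<longlonglongrightarrow> f x"
    by (intro continuous_on_tendsto_compose[OF cont[folded x_def y_def]]) auto
  then have "(\<lambda>k. s * (f (z k) - f x) + t * f (z k) * inverse (real k)) \<longlonglongrightarrow> s * (f x - f x) + t * f x * 0"
    by (intro tendsto_intros lim_inverse_n)
  then have lim: "(\<lambda>k. s * (f (z k) - f x) + t * f (z k) * inverse (real k)) \<longlonglongrightarrow> 0" by simp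
  \<comment> \<open>This combines \<open>F (k p + q) = (k s + t) f (z k)\<close> with
    \<open>F p = s f x\<close>; dividing by \<open>k\<close> requires \<open>k \<ge> 1\<close>, so
    the two sequences agree only eventually.\<close>
  have "s * (f (z k) - f x) + t * f (z k) * inverse (real k)
      = of_int (F (int k *s p + q) - int k * F p) / real k" if "k \<ge> 1" for k
  proof -
    have "of_int (F (int k *s p + q) - int k * F p) = (real k * s + t) * f (z k) - real k * (s * f x)"
      by (simp add: bspec[OF Ff mem] bspec[OF Ff pq(1)] z_def x_def s_def t_def)
    then show ?thesis using that by (simp add: field_simps)
  qed
  then show "(\<lambda>k. of_int (F (int k *s p + q) - int k * F p) / real k) \<longlonglongrightarrow> 0"
    by (intro Lim_transform_eventually[OF lim]) (auto simp: eventually_sequentially intro!: exI[of _ 1])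
qed

section \<open>Passing to the cone over the polyhedron and back\<close>

theorem theorem8p2:
  fixes S :: "(real ^ 'n) set" and f :: "real ^ 'n \<Rightarrow> real"
  assumes "rational_polyhedral S" and "bounded S"
    and "Q_convex_on S f"
    and "\<And>l. rational_line_segment l \<Longrightarrow> l \<subseteq> S \<Longrightarrow> continuous_on (l \<inter> rational_points) f"
    and "\<And>x. x \<in> S \<inter> rational_points \<Longrightarrow>
           \<exists>(b :: int) (a :: 'n \<Rightarrow> int). f x = of_int b + (\<Sum>i\<in>UNIV. of_int (a i) * x $ i)"
  shows "integral_polyhedral_on (S \<inter> rational_points) f"
proof (cases "S \<inter> rational_points = {}")
  case True
  then show ?thesis unfolding integral_polyhedral_on_def by (intro exI[of _ "{(0, 0)}"]) simp
next
  case False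
  then obtain x0 where x0: "x0 \<in> S" by blast
  obtain C where C: "finite C" "S = {x. \<forall>(a, b)\<in>C. int_affine a b x \<ge> 0}"
    using assms(1) by (rule rational_polyhedral_int_affine)
  \<comment> \<open>The constraint \<open>axis None 1\<close> keeps the denominator nonnegative; the
    others are the homogenised inequalities of \<open>S\<close>.\<close>
  define H :: "(int ^ 'n option) set" where
    "H = insert (axis None 1) ((\<lambda>(a, b). homogenize a b) ` C)"
  define M where "M = {p. \<forall>h\<in>H. 0 \<le> idot h p}"
  have finH: "finite H" using C(1) by (simp add: H_def)
  have M_iff: "p \<in> M \<longleftrightarrow> 0 \<le> p $ None \<and> (\<forall>(a, b)\<in>C. 0 \<le> idot (homogenize a b) p)" for p
    by (auto simp: M_def H_def idot_axis)
  have pos: "p \<in> M \<longleftrightarrow> dehomogenize p \<in> S" if p: "p $ None > 0" for p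
  proof -
    have "0 \<le> idot (homogenize a b) p \<longleftrightarrow> 0 \<le> int_affine a b (dehomogenize p)" for a b
    proof -
      have "0 \<le> idot (homogenize a b) p \<longleftrightarrow> 0 \<le> real_of_int (idot (homogenize a b) p)" by simp
      also have "\<dots> \<longleftrightarrow> 0 \<le> int_affine a b (dehomogenize p)"
        unfolding int_affine_dehomogenize[OF p] using p by (simp add: zero_le_mult_iff)
      finally show ?thesis .
    qed
    then show ?thesis using p by (simp add: M_iff C(2))
  qed
  \<comment> \<open>Boundedness enters here: a nonzero cone point with denominator 0 would be a
    recession direction, giving a ray from \<open>x0\<close> inside \<open>S\<close>.\<close>
  have zero: "p = 0" if p: "p \<in> M" and p0: "p $ None = 0" for p
  proof -
    define y :: "real ^ 'n" where "y = (\<chi> i. of_int (p $ Some i))"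
    have line: "x0 + t *\<^sub>R y \<in> S" if t: "t \<ge> 0" for t
    proof -
      have "0 \<le> int_affine a b (x0 + t *\<^sub>R y)" if "(a, b) \<in> C" for a b
      proof -
        have "0 \<le> idot (homogenize a b) p" using p that by (auto simp: M_iff)
        then have "0 \<le> (\<Sum>i\<in>UNIV. a $ i * p $ Some i)"
          using p0 by (simp add: idot_homogenize)
        moreover have "(\<Sum>i\<in>UNIV. of_int (a $ i) * y $ i) = of_int (\<Sum>i\<in>UNIV. a $ i * p $ Some i)"
          by (simp add: y_def)
        ultimately have "0 \<le> (\<Sum>i\<in>UNIV. of_int (a $ i) * y $ i)" by (simp only: of_int_0_le_iff)
        moreover have "0 \<le> int_affine a b x0" using x0 that by (auto simp: C(2))
        ultimately show ?thesis using t by (simp add: int_affine_line)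
      qed
      then show ?thesis by (auto simp: C(2))
    qed
    have "y = 0"
    proof (rule ccontr)
      assume y: "y \<noteq> 0"
      obtain B where B: "\<And>x. x \<in> S \<Longrightarrow> norm x \<le> B" using assms(2) by (auto simp: bounded_iff)
      \<comment> \<open>The length of \<open>t y\<close> is chosen to exceed
        \<open>B + norm x0\<close>, which bounds the distance of any point of \<open>S\<close> from
        \<open>x0\<close>.\<close>
      define t where "t = (B + norm x0 + 1) / norm y"
      have B0: "0 \<le> B" using B[OF x0] norm_ge_zero order_trans by blast
      then have t: "t \<ge> 0" by (simp add: t_def)
      have "norm (t *\<^sub>R y) = B + norm x0 + 1" using y t B0 by (simp add: t_def)
      moreover have "norm (t *\<^sub>R y) \<le> norm (x0 + t *\<^sub>R y) + norm x0"
        using norm_triangle_ineq4[of "x0 + t *\<^sub>R y" x0] by simp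
      ultimately show False using B[OF line[OF t]] by linarith
    qed
    then have "p $ j = 0" for j using p0 by (cases j) (simp_all add: y_def vec_eq_iff)
    then show "p = 0" by (simp add: vec_eq_iff)
  qed
  have M_cases: "p = 0 \<or> p $ None > 0 \<and> dehomogenize p \<in> S" if p: "p \<in> M" for p
  proof (cases "p $ None = 0")
    case True
    then show ?thesis using zero[OF p] by simp
  next
    case False
    then have "p $ None > 0" using p by (simp add: M_iff)
    then show ?thesis using pos p by simp
  qed
  \<comment> \<open>The floor serves to make \<open>F\<close> integer-valued; on \<open>M\<close> it
    is exact, because the denominator turns the assumed form of the values of \<open>f\<close> into
    an integer.\<close>
  define F where "F p = \<lfloor>of_int (p $ None) * f (dehomogenize p)\<rfloor>" for p
  have Ff: "real_of_int (F p) = of_int (p $ None) * f (dehomogenize p)" if "p \<in> M" for p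
    using M_cases[OF that]
  proof
    assume p: "p $ None > 0 \<and> dehomogenize p \<in> S"
    then have "dehomogenize p \<in> S \<inter> rational_points" using dehomogenize_rational by blast
    from assms(5)[OF this] obtain b :: int and a :: "'n \<Rightarrow> int"
      where "f (dehomogenize p) = of_int b + (\<Sum>i\<in>UNIV. of_int (a i) * dehomogenize p $ i)" by blast
    then have "of_int (p $ None) * f (dehomogenize p) = of_int (p $ None * b + (\<Sum>i\<in>UNIV. a i * p $ Some i))"
      using p by (simp add: dehomogenize_def distrib_left sum_distrib_left)
    then show ?thesis unfolding F_def by (simp only: floor_of_int)
  qed (simp add: F_def)
  have add: "p + q \<in> M" if "p \<in> M" "q \<in> M" for p q
    using that by (auto simp: M_def idot_add)
  have F: "sublinear_on M F"
    unfolding sublinear_on_def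
  proof (intro conjI ballI allI)
    fix p q assume p: "p \<in> M" and q: "q \<in> M"
    show pq: "p + q \<in> M" by (rule add[OF p q])
    show "F (p + q) \<le> F p + F q"
    proof (cases "p = 0 \<or> q = 0")
      case True
      then show ?thesis by (auto simp: F_def)
    next
      case False
      then have pqS: "p $ None > 0" "q $ None > 0" "dehomogenize p \<in> S" "dehomogenize q \<in> S"
        using M_cases[OF p] M_cases[OF q] by auto
      define s t where "s = real_of_int (p $ None)" and "t = real_of_int (q $ None)"
      have st: "s > 0" "t > 0" using pqS by (auto simp: s_def t_def)
      have eq: "dehomogenize (p + q) =
          (s / (s + t)) *\<^sub>R dehomogenize p + (1 - s / (s + t)) *\<^sub>R dehomogenize q"
        using dehomogenize_add[OF pqS(1,2)] by (simp add: s_def t_def)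
      have "s / (s + t) \<in> {0..1} \<inter> \<rat>" using st by (auto simp: s_def t_def)
      then have "f (dehomogenize (p + q))
          \<le> s / (s + t) * f (dehomogenize p) + (1 - s / (s + t)) * f (dehomogenize q)"
        unfolding eq using assms(3) pqS(3,4) dehomogenize_rational
        unfolding Q_convex_on_def by blast
      then have "(s + t) * f (dehomogenize (p + q))
          \<le> (s + t) * (s / (s + t) * f (dehomogenize p) + (1 - s / (s + t)) * f (dehomogenize q))"
        using st by (intro mult_left_mono) auto
      also have "1 - s / (s + t) = t / (s + t)" using st by (simp add: field_simps)
      also have "(s + t) * (s / (s + t) * f (dehomogenize p) + t / (s + t) * f (dehomogenize q))
          = s * f (dehomogenize p) + t * f (dehomogenize q)"
        using st by (simp add: distrib_left)
      finally have "real_of_int (F (p + q)) \<le> of_int (F p + F q)"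
        by (simp add: Ff[OF p] Ff[OF q] Ff[OF pq] s_def t_def)
      then show ?thesis by (simp only: of_int_le_iff)
    qed
  next
    fix p and k :: nat assume p: "p \<in> M"
    show kp: "int k *s p \<in> M" using p by (auto simp: M_def idot_scale)
    have "real_of_int (F (int k *s p)) = of_int (int k * F p)"
    proof (cases "k = 0")
      case False
      then show ?thesis by (simp add: Ff[OF p] Ff[OF kp] dehomogenize_scale)
    qed (simp add: F_def)
    then show "F (int k *s p) = int k * F p" by (simp only: of_int_eq_iff)
  qed
  have convS: "convex S"
  proof (rule convexI)
    fix x y :: "real ^ 'n" and s t :: real
    assume *: "x \<in> S" "y \<in> S" "0 \<le> s" "0 \<le> t" "s + t = 1"
    have "int_affine a b (s *\<^sub>R x + t *\<^sub>R y) = s * int_affine a b x + t * int_affine a b y" for a b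
    proof -
      have "(of_int b :: real) = s * of_int b + t * of_int b"
        using *(5) by (metis distrib_right mult_1)
      then show ?thesis
        by (simp add: int_affine_def sum_distrib_left sum.distrib algebra_simps)
    qed
    then show "s *\<^sub>R x + t *\<^sub>R y \<in> S" using * by (fastforce simp: C(2))
  qed
  have bdd: "\<exists>B. \<forall>k. B \<le> F (int k *s p + q) - int k * F p" if p: "p \<in> M" and q: "q \<in> M" for p q
  proof (cases "p = 0 \<or> q = 0")
    case True
    moreover have "F 0 = 0" by (simp add: F_def)
    ultimately show ?thesis using sublinear_onD(4)[OF F p] by auto
  next
    case False
    then have pqS: "p $ None > 0" "q $ None > 0" "dehomogenize p \<in> S" "dehomogenize q \<in> S"
      using M_cases[OF p] M_cases[OF q] by auto
    have "continuous_on (closed_segment (dehomogenize p) (dehomogenize q) \<inter> rational_points) f"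
    \<comment> \<open>Equal points span no rational segment, so the continuity hypothesis is silent;
      on a singleton continuity is trivial.\<close>
    proof (cases "dehomogenize p = dehomogenize q")
      case True
      then show ?thesis by (auto intro: continuous_on_subset[OF continuous_on_sing])
    next
      case False
      then show ?thesis
        using convS pqS(3,4)
        by (intro assms(4) rational_line_segmentI dehomogenize_rational closed_segment_subset)
    qed
    moreover have "\<forall>p\<in>M. real_of_int (F p) = of_int (p $ None) * f (dehomogenize p)" using Ff by blast
    ultimately show ?thesis by (intro increment_bounded_below[OF F p q pqS(1,2)])
  qed
  have "\<exists>a. (\<forall>x\<in>M. idot a x \<le> F x) \<and> idot a c = F c" if c: "c \<in> M" for c
    using sublinear_supporting_functional[OF finH, folded M_def, OF F c] bdd[OF c] by blast
  then obtain L where L: "finite L" "\<forall>a\<in>L. \<forall>x\<in>M. idot a x \<le> F x" "\<forall>x\<in>M. \<exists>a\<in>L. idot a x = F x"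
    using finitely_many_supporting_functionals[OF finH, folded M_def, of F] by metis
  define L' where "L' = (\<lambda>p. ((\<chi> i. p $ Some i), p $ None)) ` L"
  have "f x = Max ((\<lambda>(a, b). int_affine a b x) ` L')" if x: "x \<in> S \<inter> rational_points" for x
  proof -
    obtain p where p: "p $ None > 0" "dehomogenize p = x"
      using x by (auto elim: dehomogenize_rational_points)
    then have pM: "p \<in> M" using pos x by simp
    have val: "of_int (idot a p) = of_int (p $ None) * int_affine (\<chi> i. a $ Some i) (a $ None) x" for a
      using int_affine_dehomogenize[OF p(1), of "\<chi> i. a $ Some i" "a $ None"] p(2)
      by (simp add: homogenize_surj)
    have Fp: "of_int (F p) = of_int (p $ None) * f x" using Ff[OF pM] p(2) by simp
    show ?thesis
    proof (rule Max_eqI[symmetric])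
      show "finite ((\<lambda>(a, b). int_affine a b x) ` L')" using L(1) by (simp add: L'_def)
    next
      fix r assume "r \<in> (\<lambda>(a, b). int_affine a b x) ` L'"
      then obtain a where a: "a \<in> L" "r = int_affine (\<chi> i. a $ Some i) (a $ None) x" by (auto simp: L'_def)
      have "real_of_int (idot a p) \<le> of_int (F p)" using L(2) a(1) pM by simp
      then show "r \<le> f x" using p(1) by (simp add: val Fp a(2))
    next
      obtain a where a: "a \<in> L" "idot a p = F p" using L(3) pM by blast
      have "of_int (p $ None) * int_affine (\<chi> i. a $ Some i) (a $ None) x = of_int (p $ None) * f x"
        unfolding val[of a, symmetric] a(2) by (rule Fp)
      then have "f x = int_affine (\<chi> i. a $ Some i) (a $ None) x" using p(1) by simp
      then show "f x \<in> (\<lambda>(a, b). int_affine a b x) ` L'"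
        using a(1) by (auto simp: L'_def image_iff)
    qed
  qed
  \<comment> \<open>Some functional touches \<open>F\<close> at the cone point 0, so the list is
    nonempty.\<close>
  moreover have "L' \<noteq> {}"
  proof -
    have "0 \<in> M" by (simp add: M_def idot_zero)
    then show ?thesis using L(3) by (auto simp: L'_def)
  qed
  moreover have "finite L'" using L(1) by (simp add: L'_def)
  ultimately show ?thesis unfolding integral_polyhedral_on_def by blast
qed

end
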